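(* Let $A$ be a (complex) Banach algebra with $\Delta(A)\neq\emptyset$ and let $\phi\in\Delta(A)\cup\{0\}$. Then $A$ is $\Delta$-weak $\phi$-amenable if and only if $\ker(\phi)$ has a bounded $\Delta$-weak approximate identity.
   Context: $\Delta(A)$ denotes the set of all nonzero algebra homomorphisms $A\to\mathbb{C}$ (characters; these are automatically bounded), $A^{*}$ the dual space and $A^{**}$ the bidual. For $a\in A$ and $f\in A^{*}$, the functional $f.a\in A^{*}$ is defined by $(f.a)(b)=f(ab)$ for $b\in A$. For $\phi\in\Delta(A)\cup\{0\}$, $A$ is called $\Delta$-weak $\phi$-amenable if there exists $m\in A^{**}$ such that $m(\phi)=0$ and $m(\psi.a)=\psi(a)$ for all $a\in\ker(\phi)$ and all $\psi\in\Delta(A)$. For a subspace $B\subseteq A$, a $\Delta$-weak approximate identity for $B$ is a net $\{a_\alpha\}$ in $B$ such that $\lim_\alpha|\psi(aa_\alpha)-\psi(a)|=0$ for all $a\in B$ and all $\psi\in\Delta(A)$; it is bounded if $\sup_\alpha\|a_\alpha\|<\infty$. When $\phi=0$, $\ker(\phi)=A$. *)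

theory Defs
  imports "HOL-Analysis.Analysis"
begin

text \<open>The library only provides real normed algebras. A complex Banach algebra (not assumed
  unital or commutative) is a complete real normed algebra whose scalar multiplication extends
  to the complex numbers.\<close>

class scaleC = scaleR +
  fixes scaleC :: "complex \<Rightarrow> 'a \<Rightarrow> 'a" (infixr \<open>*\<^sub>C\<close> 75)
  assumes scaleR_scaleC: "r *\<^sub>R x = complex_of_real r *\<^sub>C x"

class complex_banach_algebra = scaleC + real_normed_algebra + banach +
  assumes scaleC_add_right: "c *\<^sub>C (x + y) = c *\<^sub>C x + c *\<^sub>C y"
    and scaleC_add_left: "(c + d) *\<^sub>C x = c *\<^sub>C x + d *\<^sub>C x"
    and scaleC_scaleC: "c *\<^sub>C d *\<^sub>C x = (c * d) *\<^sub>C x"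
    and scaleC_one: "1 *\<^sub>C x = x"
    and mult_scaleC_left: "(c *\<^sub>C x) * y = c *\<^sub>C (x * y)"
    and mult_scaleC_right: "x * (c *\<^sub>C y) = c *\<^sub>C (x * y)"
    and norm_scaleC: "norm (c *\<^sub>C x) = cmod c * norm x"

instantiation complex :: complex_banach_algebra
begin

definition scaleC_complex :: "complex \<Rightarrow> complex \<Rightarrow> complex"
  where "scaleC_complex c x = c * x"

instance
  by standard (auto simp: scaleC_complex_def scaleR_conv_of_real algebra_simps norm_mult)

end

definition Delta :: "('a::complex_banach_algebra \<Rightarrow> complex) set"
  where "Delta = {\<phi>. Vector_Spaces.linear scaleC (*) \<phi> \<and> (\<forall>x y. \<phi> (x * y) = \<phi> x * \<phi> y)
                    \<and> \<phi> \<noteq> (\<lambda>_. 0)}"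

definition dual :: "('a::complex_banach_algebra \<Rightarrow> complex) set"
  where "dual = {f. Vector_Spaces.linear scaleC (*) f \<and> bounded_linear f}"

text \<open>Elements of the bidual are functions on all of \<open>'a \<Rightarrow> complex\<close> of which only the values on
  \<^const>\<open>dual\<close> matter (elsewhere they are arbitrary); there they are complex linear and bounded for the dual norm \<^const>\<open>onorm\<close>.\<close>

definition bidual :: "(('a::complex_banach_algebra \<Rightarrow> complex) \<Rightarrow> complex) set"
  where "bidual = {m. (\<forall>f\<in>dual. \<forall>g\<in>dual. m (\<lambda>x. f x + g x) = m f + m g)
                    \<and> (\<forall>c. \<forall>f\<in>dual. m (\<lambda>x. c * f x) = c * m f)
                    \<and> (\<exists>K. \<forall>f\<in>dual. cmod (m f) \<le> K * onorm f)}"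

definition dual_act :: "('a::complex_banach_algebra \<Rightarrow> complex) \<Rightarrow> 'a \<Rightarrow> ('a \<Rightarrow> complex)"
  where "dual_act f a = (\<lambda>b. f (a * b))"

definition ker :: "('a::complex_banach_algebra \<Rightarrow> complex) \<Rightarrow> 'a set"
  where "ker \<phi> = {a. \<phi> a = 0}"

definition Delta_weak_amenable :: "('a::complex_banach_algebra \<Rightarrow> complex) \<Rightarrow> bool"
  where "Delta_weak_amenable \<phi> \<longleftrightarrow>
    (\<exists>m\<in>bidual. m \<phi> = 0 \<and> (\<forall>a\<in>ker \<phi>. \<forall>\<psi>\<in>Delta. m (dual_act \<psi> a) = \<psi> a))"

text \<open>The lemmas \<open>Delta_subset_dual\<close>, \<open>zero_in_dual\<close> and \<open>dual_act_in_dual\<close> below show that \<open>m\<close> above is only ever evaluated on elements of \<^const>\<open>dual\<close>.\<close>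

lemma vector_space_scaleC: "vector_space (scaleC :: complex \<Rightarrow> 'a \<Rightarrow> 'a::complex_banach_algebra)"
  by standard (auto simp: scaleC_add_right scaleC_add_left scaleC_scaleC scaleC_one)

lemma clinear_iff:
  "Vector_Spaces.linear scaleC (*) (f :: 'a::complex_banach_algebra \<Rightarrow> complex) \<longleftrightarrow>
     (\<forall>x y. f (x + y) = f x + f y) \<and> (\<forall>c x. f (c *\<^sub>C x) = c * f x)"
proof -
  have "vector_space ((*) :: complex \<Rightarrow> complex \<Rightarrow> complex)"
    by standard (auto simp: algebra_simps)
  then show ?thesis
    by (auto simp: Vector_Spaces.linear_iff vector_space_scaleC)
qed

lemma clinear_imp_linear:
  assumes "Vector_Spaces.linear scaleC (*) (f :: 'a::complex_banach_algebra \<Rightarrow> complex)"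
  shows "linear f"
  using assms by (intro linearI) (auto simp: clinear_iff scaleR_scaleC scaleC_complex_def)

lemma cmod_character_le:
  fixes \<phi> :: "'a::complex_banach_algebra \<Rightarrow> complex"
  assumes "\<phi> \<in> Delta"
  shows "cmod (\<phi> a) \<le> norm a"
proof (rule ccontr)
  assume "\<not> ?thesis"
  then have less: "norm a < cmod (\<phi> a)" by simp
  then have nz: "\<phi> a \<noteq> 0" by auto
  have add: "\<phi> (x + y) = \<phi> x + \<phi> y" and sc: "\<phi> (c *\<^sub>C x) = c * \<phi> x"
    and mul: "\<phi> (x * y) = \<phi> x * \<phi> y" for x y c
    using assms by (auto simp: Delta_def clinear_iff)
  define b where "b = inverse (\<phi> a) *\<^sub>C a"
  have nb: "norm b < 1"
    using less nz by (simp add: b_def norm_scaleC norm_inverse pos_divide_less_eq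
        divide_inverse[symmetric] mult.commute[of "inverse _"])
  have b1: "\<phi> b = 1" using nz by (simp add: b_def sc)
  define p where "p n = ((\<lambda>y. b * y) ^^ n) b" for n
  have p0: "p 0 = b" and pS: "p (Suc n) = b * p n" for n by (auto simp: p_def)
  have "norm (p n) \<le> norm b ^ Suc n" for n
  proof (induction n)
    case (Suc n)
    have "norm (p (Suc n)) \<le> norm b * norm (p n)" by (simp add: pS norm_mult_ineq)
    also have "\<dots> \<le> norm b * norm b ^ Suc n" by (intro mult_left_mono Suc) auto
    finally show ?case by simp
  qed (simp add: p0)
  moreover have "summable (\<lambda>n. norm b ^ Suc n)"
    using nb by (simp add: summable_mult summable_geometric)
  ultimately have summ: "summable p" by (intro summable_comparison_test[of p "\<lambda>n. norm b ^ Suc n"]) auto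
  define c where "c = suminf p"
  have "b * c = (\<Sum>n. b * p n)" unfolding c_def using summ by (rule suminf_mult[symmetric])
  also have "\<dots> = (\<Sum>n. p (Suc n))" by (simp add: pS)
  also have "\<dots> = c - b" using suminf_split_head[OF summ] by (simp add: c_def p0)
  finally have "c = b * c + b" by simp
  then have "\<phi> c = \<phi> (b * c) + \<phi> b" by (metis add)
  then show False by (simp add: mul b1)
qed

lemma Delta_subset_dual: "Delta \<subseteq> dual"
proof
  fix \<phi> :: "'a \<Rightarrow> complex"
  assume *: "\<phi> \<in> Delta"
  then have lin: "Vector_Spaces.linear scaleC (*) \<phi>" by (simp add: Delta_def)
  have "bounded_linear \<phi>"
    using clinear_imp_linear[OF lin] cmod_character_le[OF *]
    by (auto simp: bounded_linear_def bounded_linear_axioms_def intro!: exI[of _ 1])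
  with lin show "\<phi> \<in> dual" by (simp add: dual_def)
qed

lemma zero_in_dual: "(\<lambda>_. 0) \<in> dual"
  by (simp add: dual_def clinear_iff)

lemma dual_act_in_dual: "f \<in> dual \<Longrightarrow> dual_act f a \<in> dual"
  using bounded_linear_compose[OF _ bounded_linear_mult_right, of f a]
  by (auto simp: dual_def dual_act_def clinear_iff distrib_left mult_scaleC_right)

definition directed_set :: "'i set \<Rightarrow> ('i \<Rightarrow> 'i \<Rightarrow> bool) \<Rightarrow> bool"
  where "directed_set I le \<longleftrightarrow> I \<noteq> {} \<and> (\<forall>i\<in>I. le i i)
     \<and> (\<forall>i\<in>I. \<forall>j\<in>I. \<forall>k\<in>I. le i j \<longrightarrow> le j k \<longrightarrow> le i k)
     \<and> (\<forall>i\<in>I. \<forall>j\<in>I. \<exists>k\<in>I. le i k \<and> le j k)"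

definition net_filter :: "'i set \<Rightarrow> ('i \<Rightarrow> 'i \<Rightarrow> bool) \<Rightarrow> 'i filter"
  where "net_filter I le = (INF i\<in>I. principal {j\<in>I. le i j})"

lemma eventually_net_filter:
  assumes "directed_set I le"
  shows "eventually P (net_filter I le) \<longleftrightarrow> (\<exists>i\<in>I. \<forall>j\<in>I. le i j \<longrightarrow> P j)"
  unfolding net_filter_def
proof (subst eventually_INF_base)
  fix i j assume ij: "i \<in> I" "j \<in> I"
  then obtain k where k: "k \<in> I" "le i k" "le j k"
    using assms unfolding directed_set_def by meson
  have "le i l \<and> le j l" if "l \<in> I" "le k l" for l
    using assms ij k that unfolding directed_set_def by meson
  then have "{l \<in> I. le k l} \<subseteq> {l \<in> I. le i l} \<inter> {l \<in> I. le j l}"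
    by blast
  then show "\<exists>k\<in>I. principal {l \<in> I. le k l}
      \<le> inf (principal {l \<in> I. le i l}) (principal {l \<in> I. le j l})"
    using k(1) by auto
next
  show "I \<noteq> {}" using assms unfolding directed_set_def by (elim conjE)
  show "(\<exists>i\<in>I. eventually P (principal {j \<in> I. le i j})) \<longleftrightarrow> (\<exists>i\<in>I. \<forall>j\<in>I. le i j \<longrightarrow> P j)"
    by (auto simp: eventually_principal)
qed

definition Delta_weak_approx_id ::
    "'a::complex_banach_algebra set \<Rightarrow> 'i set \<Rightarrow> ('i \<Rightarrow> 'i \<Rightarrow> bool) \<Rightarrow> ('i \<Rightarrow> 'a) \<Rightarrow> bool"
  where "Delta_weak_approx_id B I le e \<longleftrightarrow> directed_set I le \<and> e ` I \<subseteq> B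
     \<and> (\<forall>a\<in>B. \<forall>\<psi>\<in>Delta. ((\<lambda>i. cmod (\<psi> (a * e i) - \<psi> a)) \<longlongrightarrow> 0) (net_filter I le))"

text \<open>HOL cannot quantify existentially over the type of the index set of a net. The type
  \<open>'a \<times> 'a set\<close> is large enough: by the lemma below, a bounded net over any index type can be
  replaced by one over this type.\<close>

definition has_bounded_Delta_weak_approx_id :: "'a::complex_banach_algebra set \<Rightarrow> bool"
  where "has_bounded_Delta_weak_approx_id B \<longleftrightarrow>
    (\<exists>(I :: ('a \<times> 'a set) set) le e. Delta_weak_approx_id B I le e \<and> bounded (e ` I))"

lemma has_bounded_Delta_weak_approx_idI:
  fixes I :: "'i set" and e :: "'i \<Rightarrow> 'a::complex_banach_algebra"
  assumes net: "Delta_weak_approx_id B I le e" and bdd: "bounded (e ` I)"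
  shows "has_bounded_Delta_weak_approx_id B"
proof -
  have dir: "directed_set I le" and sub: "e ` I \<subseteq> B" using net by (auto simp: Delta_weak_approx_id_def)
  define F where "F = net_filter I le"
  have "I \<noteq> {}" and refl: "i \<in> I \<Longrightarrow> le i i" for i
    using dir unfolding directed_set_def by simp_all
  have ntb: "F \<noteq> bot"
    using refl unfolding trivial_limit_def F_def eventually_net_filter[OF dir] by blast
  have inI: "\<forall>\<^sub>F i in F. i \<in> I"
    using \<open>I \<noteq> {}\<close> unfolding F_def eventually_net_filter[OF dir] by blast
  define J where "J = {(x, S). x \<in> S \<and> x \<in> e ` I \<and> (\<forall>\<^sub>F i in F. e i \<in> S)}"
  define le' :: "'a \<times> 'a set \<Rightarrow> 'a \<times> 'a set \<Rightarrow> bool" where "le' = (\<lambda>(x, S) (y, T). T \<subseteq> S)"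
  have ex: "\<exists>x. (x, S) \<in> J" if "\<forall>\<^sub>F i in F. e i \<in> S" for S
  proof -
    have "\<exists>i. i \<in> I \<and> e i \<in> S"
      using eventually_happens[OF eventually_conj[OF inI that]] ntb by auto
    then show ?thesis using that by (auto simp: J_def)
  qed
  have dir': "directed_set J le'"
    unfolding directed_set_def
  proof (intro conjI ballI)
    show "J \<noteq> {}" using ex[of UNIV] by auto
    fix i j assume "i \<in> J" "j \<in> J"
    then have "\<forall>\<^sub>F k in F. e k \<in> snd i \<inter> snd j" by (auto simp: J_def eventually_conj)
    from ex[OF this] obtain x where "(x, snd i \<inter> snd j) \<in> J" ..
    moreover have "le' i (x, snd i \<inter> snd j)" "le' j (x, snd i \<inter> snd j)"
      by (simp_all add: le'_def split_beta)
    ultimately show "\<exists>k\<in>J. le' i k \<and> le' j k" by blast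
  qed (auto simp: le'_def)
  have "((\<lambda>j. cmod (\<psi> (a * fst j) - \<psi> a)) \<longlongrightarrow> 0) (net_filter J le')"
    if "a \<in> B" "\<psi> \<in> Delta" for a \<psi>
  proof (rule tendstoI)
    fix r :: real assume "0 < r"
    define S where "S = {x. dist (cmod (\<psi> (a * x) - \<psi> a)) 0 < r}"
    have "((\<lambda>i. cmod (\<psi> (a * e i) - \<psi> a)) \<longlongrightarrow> 0) F"
      using net that by (auto simp: Delta_weak_approx_id_def F_def)
    from tendstoD[OF this \<open>0 < r\<close>] have "\<forall>\<^sub>F i in F. e i \<in> S" by (simp add: S_def)
    from ex[OF this] obtain x where "(x, S) \<in> J" ..
    moreover have "\<forall>j\<in>J. le' (x, S) j \<longrightarrow> fst j \<in> S" by (auto simp: J_def le'_def)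
    ultimately have "\<forall>\<^sub>F j in net_filter J le'. fst j \<in> S"
      unfolding eventually_net_filter[OF dir'] by blast
    then show "\<forall>\<^sub>F j in net_filter J le'. dist (cmod (\<psi> (a * fst j) - \<psi> a)) 0 < r"
      by (simp add: S_def)
  qed
  moreover have "fst ` J \<subseteq> e ` I" by (auto simp: J_def)
  ultimately have "Delta_weak_approx_id B J le' fst" "bounded (fst ` J)"
    using dir' sub bdd by (auto simp: Delta_weak_approx_id_def intro: bounded_subset)
  then show ?thesis unfolding has_bounded_Delta_weak_approx_id_def by blast
qed

end

theory Submission
  imports Defs
begin

text \<open>The functional \<open>\<psi>.a\<close> evaluated at \<open>e\<close> is \<open>\<psi> (a e)\<close>, so a bounded \<open>\<Delta>\<close>-weak approximate identity
  is a bounded net along which \<open>\<psi>.a\<close> tends to \<open>\<psi> a\<close>. By Goldstine's theorem an element \<open>m\<close> of the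
  bidual is the weak-* limit of a bounded net in \<open>A\<close>; subtracting \<open>\<phi> (e) u\<close> with \<open>\<phi> u = 1\<close> moves that
  net into the kernel without changing the limits, because \<open>m \<phi> = 0\<close>. Conversely, \<open>m\<close> is a weak-*
  cluster point of the approximate identity, which exists by Tychonoff's theorem.\<close>

section \<open>Linear algebra of the dual and the bidual\<close>

lemma dual_bounded_linear: "f \<in> dual \<Longrightarrow> bounded_linear f"
  by (simp add: dual_def)

lemma dual_add_arg: "f \<in> dual \<Longrightarrow> f (x + y) = f x + f y"
  and dual_scaleC_arg: "f \<in> dual \<Longrightarrow> f (c *\<^sub>C x) = c * f x"
  by (auto simp: dual_def clinear_iff)

lemma dual_diff_arg: "f \<in> dual \<Longrightarrow> f (x - y) = f x - f y"
  using bounded_linear.linear[OF dual_bounded_linear] by (rule linear_diff)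

lemma dual_scaleR_arg: "f \<in> dual \<Longrightarrow> f (r *\<^sub>R x) = r * f x"
  by (simp add: scaleR_scaleC dual_scaleC_arg)

lemma cmod_dual_le: "f \<in> dual \<Longrightarrow> cmod (f x) \<le> onorm f * norm x"
  by (simp add: dual_bounded_linear onorm)

lemma dual_add: "f \<in> dual \<Longrightarrow> g \<in> dual \<Longrightarrow> (\<lambda>x. f x + g x) \<in> dual"
  by (auto simp: dual_def clinear_iff bounded_linear_add algebra_simps)

lemma dual_mult: "f \<in> dual \<Longrightarrow> (\<lambda>x. c * f x) \<in> dual"
  by (auto simp: dual_def clinear_iff algebra_simps intro: bounded_linear_const_mult)

lemma dual_sum: "(\<And>i. i \<in> F \<Longrightarrow> f i \<in> dual) \<Longrightarrow> (\<lambda>x. \<Sum>i\<in>F. f i x) \<in> dual"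
  by (induction F rule: infinite_finite_induct) (auto simp: zero_in_dual dual_add)

lemma bidual_mult: "m \<in> bidual \<Longrightarrow> f \<in> dual \<Longrightarrow> m (\<lambda>x. c * f x) = c * m f"
  by (simp add: bidual_def)

lemma bidual_add: "m \<in> bidual \<Longrightarrow> f \<in> dual \<Longrightarrow> g \<in> dual \<Longrightarrow> m (\<lambda>x. f x + g x) = m f + m g"
  by (simp add: bidual_def)

lemma bidual_zero: "m \<in> bidual \<Longrightarrow> m (\<lambda>_. 0) = 0"
  using bidual_mult[OF _ zero_in_dual, of m 0] by simp

lemma bidual_sum:
  assumes "m \<in> bidual" "\<And>i. i \<in> F \<Longrightarrow> f i \<in> dual"
  shows "m (\<lambda>x. \<Sum>i\<in>F. f i x) = (\<Sum>i\<in>F. m (f i))"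
  using assms(2)
proof (induction F rule: infinite_finite_induct)
  case (insert j F)
  have "m (\<lambda>x. f j x + (\<Sum>i\<in>F. f i x)) = m (f j) + m (\<lambda>x. \<Sum>i\<in>F. f i x)"
    using insert.prems by (intro bidual_add[OF assms(1)] dual_sum) auto
  then show ?case using insert by simp
qed (simp_all add: bidual_zero[OF assms(1)])

lemma bidual_bound:
  assumes "m \<in> bidual"
  obtains K where "K > 0" "\<And>f. f \<in> dual \<Longrightarrow> cmod (m f) \<le> K * onorm f"
proof -
  obtain K where K: "\<And>f. f \<in> dual \<Longrightarrow> cmod (m f) \<le> K * onorm f"
    using assms unfolding bidual_def by blast
  \<comment> \<open>A bound from \<open>bidual\<close> may be zero or negative; raising it to at
    least 1 makes it a usable radius of a ball.\<close>
  have "cmod (m f) \<le> max K 1 * onorm f" if "f \<in> dual" for f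
    using K[OF that] mult_right_mono[of K "max K 1" "onorm f"]
      onorm_pos_le[OF dual_bounded_linear[OF that]] by linarith
  then show ?thesis by (intro that[of "max K 1"]) auto
qed

section \<open>Goldstine's theorem\<close>

text \<open>A ball is invariant under unimodular scalars, so a value of \<open>g\<close> can be
  rotated onto the nonnegative real axis. Bounding real parts over the ball therefore bounds
  moduli.\<close>

lemma onorm_le_of_Re_le:
  assumes g: "g \<in> dual" and "K > 0" and le: "\<And>y. norm y \<le> K \<Longrightarrow> Re (g y) \<le> s"
  shows "K * onorm g \<le> s"
proof -
  have "0 \<le> s" using le[of 0] \<open>K > 0\<close> dual_scaleR_arg[OF g, of 0 0] by simp
  have "norm (g z) \<le> s / K * norm z" for z
  proof (cases "g z = 0 \<or> z = 0")
    case True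
    then show ?thesis using \<open>0 \<le> s\<close> \<open>K > 0\<close> dual_scaleR_arg[OF g, of 0 0] by auto
  next
    case False
    \<comment> \<open>The factor \<open>c\<close> rescales \<open>z\<close> to norm \<open>K\<close>
      and turns \<open>g z\<close> into a positive real number.\<close>
    define c where "c = complex_of_real (K / norm z) * cnj (sgn (g z))"
    have "norm (c *\<^sub>C z) = K"
      using False \<open>K > 0\<close> by (simp add: c_def norm_scaleC norm_mult norm_divide norm_sgn)
    moreover have "cnj (sgn (g z)) * g z = complex_of_real (cmod (g z))"
      using False by (simp add: sgn_eq complex_norm_square[symmetric] mult.commute power2_eq_square
          field_simps)
    then have "g (c *\<^sub>C z) = complex_of_real (K / norm z * cmod (g z))"
      by (simp add: c_def dual_scaleC_arg[OF g] mult.assoc)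
    ultimately have "K / norm z * cmod (g z) \<le> s"
      using le[of "c *\<^sub>C z"] by (metis Re_complex_of_real order_refl)
    then show ?thesis using False \<open>K > 0\<close> by (simp add: field_simps)
  qed
  then have "onorm g \<le> s / K" using \<open>0 \<le> s\<close> \<open>K > 0\<close> by (intro onorm_bound) auto
  then show ?thesis using \<open>K > 0\<close> by (simp add: field_simps)
qed

text \<open>With \<open>w = m f - f x\<close> and \<open>z = f (y - x)\<close>, summing over
  \<open>f\<close> gives the change of the squared distance along a segment; its linear term is
  governed by the real part of a single functional.\<close>

lemma cmod_diff_scaled_square:
  "(cmod (w - complex_of_real t * z))\<^sup>2 = (cmod w)\<^sup>2 - 2 * t * Re (cnj w * z) + t\<^sup>2 * (cmod z)\<^sup>2"
  unfolding cmod_power2 by (simp add: algebra_simps power2_eq_square)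

text \<open>A near minimiser \<open>x\<close> of the squared distance \<open>q\<close> over the ball of radius
  \<open>K\<close> almost maximises the real part of the functional \<open>g = \<Sum> cnj (m f - f x) f\<close> over that ball, so
  \<open>Re (m g) \<le> K * onorm g\<close> is at most slightly larger than \<open>Re (g x)\<close>; but their difference is \<open>q x\<close>.\<close>

lemma goldstine:
  assumes m: "m \<in> bidual" and "K > 0" and K: "\<And>f. f \<in> dual \<Longrightarrow> cmod (m f) \<le> K * onorm f"
    and F: "finite F" "F \<subseteq> dual" and "\<epsilon> > 0"
  shows "\<exists>x. norm x \<le> K \<and> (\<forall>f\<in>F. cmod (f x - m f) < \<epsilon>)"
proof -
  define q where "q x = (\<Sum>f\<in>F. (cmod (m f - f x))\<^sup>2)" for x
  define M where "M = (\<Sum>f\<in>F. (onorm f * (2 * K))\<^sup>2)"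
  define d where "d = Inf (q ` cball 0 K)"
  \<comment> \<open>\<open>\<eta>\<close> is a step length: at most 1, so that a step towards a
    point of the ball stays inside, and small enough that the final error
    \<open>\<eta> * (1 + M) / 2\<close> is below \<open>\<epsilon>\<close> squared. \<open>M\<close>
    bounds the quadratic term, as two points of the ball are at most \<open>2 * K\<close>
    apart.\<close>
  define \<eta> where "\<eta> = min 1 (\<epsilon>\<^sup>2 / (1 + M))"
  have "M \<ge> 0" by (simp add: M_def sum_nonneg)
  then have \<eta>: "0 < \<eta>" "\<eta> \<le> 1" using \<open>\<epsilon> > 0\<close> by (auto simp: \<eta>_def)
  have "\<eta> \<le> \<epsilon>\<^sup>2 / (1 + M)" by (simp add: \<eta>_def)
  then have \<eta>M: "\<eta> * (1 + M) \<le> \<epsilon>\<^sup>2" using \<open>M \<ge> 0\<close> by (simp add: pos_le_divide_eq)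
  have bdd: "bdd_below (q ` cball 0 K)"
    by (rule bdd_belowI[of _ 0]) (auto simp: q_def sum_nonneg)
  have "q ` cball 0 K \<noteq> {}" using \<open>K > 0\<close> by simp
  \<comment> \<open>The gap to the infimum has the order of the quadratic term, so an error of order
    \<open>\<eta>\<close> survives division by \<open>\<eta>\<close>.\<close>
  moreover have "d < d + \<eta>\<^sup>2" using \<eta> by simp
  ultimately obtain x where x: "norm x \<le> K" and qx: "q x < d + \<eta>\<^sup>2"
    unfolding d_def by (subst (asm) cInf_less_iff[OF _ bdd]) auto
  define w where "w f = m f - f x" for f
  have qw: "q x = (\<Sum>f\<in>F. (cmod (w f))\<^sup>2)" by (simp add: q_def w_def)
  define g where "g = (\<lambda>y. \<Sum>f\<in>F. cnj (w f) * f y)"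
  have g: "g \<in> dual" using F unfolding g_def by (intro dual_sum dual_mult) auto
  have "Re (g y) \<le> Re (g x) + \<eta> * (1 + M) / 2" if y: "norm y \<le> K" for y
  proof -
    \<comment> \<open>First variation: moving from \<open>x\<close> a fraction \<open>\<eta>\<close>
      of the way to \<open>y\<close> cannot bring \<open>q\<close> below \<open>d\<close>.\<close>
    define z where "z = x + \<eta> *\<^sub>R (y - x)"
    have "z = (1 - \<eta>) *\<^sub>R x + \<eta> *\<^sub>R y" by (simp add: z_def algebra_simps)
    then have "z \<in> cball 0 K"
      using convexD[OF convex_cball, of x "0::'a" K y "1 - \<eta>" \<eta>] x y \<eta> by simp
    then have "d \<le> q z" unfolding d_def by (intro cInf_lower bdd) auto
    also have "q z = (\<Sum>f\<in>F. (cmod (w f - complex_of_real \<eta> * f (y - x)))\<^sup>2)"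
      using F unfolding q_def
      by (intro sum.cong)
        (auto simp: z_def w_def dual_add_arg dual_scaleR_arg dual_diff_arg algebra_simps subset_iff)
    also have "\<dots> = q x - 2 * \<eta> * Re (g (y - x)) + \<eta>\<^sup>2 * (\<Sum>f\<in>F. (cmod (f (y - x)))\<^sup>2)"
      by (simp only: cmod_diff_scaled_square sum.distrib sum_subtractf g_def qw Re_sum
          sum_distrib_left)
    also have "(\<Sum>f\<in>F. (cmod (f (y - x)))\<^sup>2) \<le> M"
      unfolding M_def
    proof (intro sum_mono power_mono)
      fix f assume "f \<in> F"
      then have f: "f \<in> dual" using F by auto
      have "norm (y - x) \<le> 2 * K" using norm_triangle_ineq4[of y x] x y by linarith
      then have "onorm f * norm (y - x) \<le> onorm f * (2 * K)"
        by (intro mult_left_mono onorm_pos_le dual_bounded_linear f)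
      then show "cmod (f (y - x)) \<le> onorm f * (2 * K)"
        using cmod_dual_le[OF f] order_trans by blast
    qed simp
    finally have "d \<le> q x - 2 * \<eta> * Re (g (y - x)) + \<eta>\<^sup>2 * M"
      by (simp add: mult_left_mono)
    then have "\<eta> * (2 * Re (g (y - x))) \<le> \<eta> * (\<eta> * (1 + M))"
      using qx by (simp add: algebra_simps power2_eq_square)
    then have "2 * Re (g (y - x)) \<le> \<eta> * (1 + M)" using \<eta> by simp
    then show ?thesis by (simp add: dual_diff_arg[OF g])
  qed
  from onorm_le_of_Re_le[OF g \<open>K > 0\<close> this]
  have "Re (m g) \<le> Re (g x) + \<eta> * (1 + M) / 2"
    using K[OF g] complex_Re_le_cmod[of "m g"] by linarith
  moreover have "m g = (\<Sum>f\<in>F. cnj (w f) * m f)"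
    using F unfolding g_def
    by (subst bidual_sum[OF m]) (auto intro!: sum.cong dual_mult simp: bidual_mult[OF m] subset_iff)
  then have "m g = g x + (\<Sum>f\<in>F. cnj (w f) * w f)"
    by (simp add: g_def w_def sum.distrib[symmetric] algebra_simps)
  then have "Re (m g) = Re (g x) + q x"
    by (simp only: qw cmod_power2 plus_complex.sel Re_sum) (simp add: power2_eq_square)
  ultimately have "q x < \<epsilon>\<^sup>2" using \<eta>M \<open>\<epsilon> > 0\<close> zero_less_power[of \<epsilon> 2] by linarith
  have "cmod (f x - m f) < \<epsilon>" if "f \<in> F" for f
  proof -
    have "(cmod (m f - f x))\<^sup>2 \<le> q x"
      unfolding q_def using that F by (intro member_le_sum) auto
    then have "(cmod (f x - m f))\<^sup>2 < \<epsilon>\<^sup>2"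
      using \<open>q x < \<epsilon>\<^sup>2\<close> by (simp add: norm_minus_commute)
    then show ?thesis using \<open>\<epsilon> > 0\<close> by (simp add: power2_less_imp_less)
  qed
  then show ?thesis using x by blast
qed

text \<open>An index pairs a finite set of functionals with an accuracy \<open>1 / (n + 1)\<close>;
  Goldstine's theorem supplies a point for each index.\<close>

lemma bidual_weak_star_limit:
  fixes m :: "('a::complex_banach_algebra \<Rightarrow> complex) \<Rightarrow> complex"
  assumes m: "m \<in> bidual"
  obtains I :: "(('a \<Rightarrow> complex) set \<times> nat) set" and le e K
  where "directed_set I le" "\<And>i. i \<in> I \<Longrightarrow> norm (e i) \<le> K"
    "\<And>f. f \<in> dual \<Longrightarrow> ((\<lambda>i. f (e i)) \<longlongrightarrow> m f) (net_filter I le)"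
proof -
  obtain K where "K > 0" and K: "\<And>f. f \<in> dual \<Longrightarrow> cmod (m f) \<le> K * onorm f"
    using bidual_bound[OF m] by blast
  define I :: "(('a \<Rightarrow> complex) set \<times> nat) set"
    where "I = {(F, n). finite F \<and> F \<subseteq> dual}"
  define le :: "('a \<Rightarrow> complex) set \<times> nat \<Rightarrow> ('a \<Rightarrow> complex) set \<times> nat \<Rightarrow> bool"
    where "le = (\<lambda>(F, n) (G, k). F \<subseteq> G \<and> n \<le> k)"
  have dir: "directed_set I le"
    unfolding directed_set_def
  proof (intro conjI ballI)
    have "({}, 0) \<in> I" by (simp add: I_def)
    then show "I \<noteq> {}" by blast
    fix i j assume "i \<in> I" "j \<in> I"
    then show "\<exists>k\<in>I. le i k \<and> le j k"
      by (intro bexI[of _ "(fst i \<union> fst j, max (snd i) (snd j))"]) (auto simp: I_def le_def)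
  qed (auto simp: le_def)
  have "\<forall>i\<in>I. \<exists>x. norm x \<le> K \<and> (\<forall>f\<in>fst i. cmod (f x - m f) < inverse (real (Suc (snd i))))"
    by (intro ballI goldstine[OF m \<open>K > 0\<close> K]) (auto simp: I_def)
  then obtain e where e: "\<And>i. i \<in> I \<Longrightarrow> norm (e i) \<le> K"
    and close: "\<And>i f. i \<in> I \<Longrightarrow> f \<in> fst i \<Longrightarrow> cmod (f (e i) - m f) < inverse (real (Suc (snd i)))"
    by metis
  have "((\<lambda>i. f (e i)) \<longlongrightarrow> m f) (net_filter I le)" if "f \<in> dual" for f
  proof (rule tendstoI)
    fix r :: real assume "0 < r"
    then obtain n where n: "inverse (real (Suc n)) < r" using reals_Archimedean by blast
    \<comment> \<open>Every index beyond \<open>({f}, n)\<close> still controls \<open>f\<close>, at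
      least as accurately.\<close>
    have "dist (f (e j)) (m f) < r" if "j \<in> I" "le ({f}, n) j" for j
    proof -
      have "f \<in> fst j" "n \<le> snd j" using that by (auto simp: le_def)
      then have "inverse (real (Suc (snd j))) \<le> inverse (real (Suc n))" by simp
      then show ?thesis using close[OF \<open>j \<in> I\<close> \<open>f \<in> fst j\<close>] n unfolding dist_norm by linarith
    qed
    moreover have "({f}, n) \<in> I" using \<open>f \<in> dual\<close> by (simp add: I_def)
    ultimately show "\<forall>\<^sub>F i in net_filter I le. dist (f (e i)) (m f) < r"
      unfolding eventually_net_filter[OF dir] by blast
  qed
  then show ?thesis using that dir e by blast
qed

section \<open>Compactness and weak-* cluster points\<close>

text \<open>Tychonoff's theorem: the set is a product of closed discs, and the function type carries
  the product topology.\<close>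

lemma compact_functions_in_cballs:
  "compact {g :: 'b \<Rightarrow> complex. \<forall>f. g f \<in> cball 0 (B f)}"
proof -
  have "compactin (product_topology (\<lambda>_. euclidean) UNIV) (PiE UNIV (\<lambda>f. cball (0::complex) (B f)))"
    by (subst compactin_PiE) auto
  moreover have "PiE UNIV (\<lambda>f. cball (0::complex) (B f)) = {g. \<forall>f. g f \<in> cball 0 (B f)}"
    by (auto simp: PiE_def Pi_def)
  ultimately show ?thesis by (simp add: euclidean_product_topology)
qed

text \<open>The cluster point comes with a finer filter \<open>H\<close> along which there is
  genuine convergence; linearity and the bound then pass to the limit.\<close>

lemma weak_star_cluster_point:
  fixes e :: "'i \<Rightarrow> 'a::complex_banach_algebra"
  assumes "F \<noteq> bot" and bdd: "\<forall>\<^sub>F i in F. norm (e i) \<le> C"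
  obtains m H where "m \<in> bidual" "H \<noteq> bot" "H \<le> F"
    "\<And>f. f \<in> dual \<Longrightarrow> ((\<lambda>i. f (e i)) \<longlongrightarrow> m f) H"
proof -
  \<comment> \<open>The product runs over all functions, so coordinates outside \<open>dual\<close>
    are set to 0, with discs of radius 0 there.\<close>
  define \<Phi> :: "'i \<Rightarrow> ('a \<Rightarrow> complex) \<Rightarrow> complex"
    where "\<Phi> i f = (if f \<in> dual then f (e i) else 0)" for i f
  define B :: "('a \<Rightarrow> complex) \<Rightarrow> real" where "B f = onorm f * C" for f
  define B' where "B' f = (if f \<in> dual then B f else 0)" for f
  have bound: "\<forall>\<^sub>F i in F. \<forall>f\<in>dual. cmod (f (e i)) \<le> B f"
    using bdd
  proof eventually_elim
    case (elim i)
    then show ?case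
      by (metis B_def cmod_dual_le dual_bounded_linear mult_left_mono onorm_pos_le order_trans)
  qed
  then have "\<forall>\<^sub>F g in filtermap \<Phi> F. g \<in> {g. \<forall>f. g f \<in> cball 0 (B' f)}"
    unfolding eventually_filtermap by eventually_elim (auto simp: \<Phi>_def B'_def)
  moreover have "filtermap \<Phi> F \<noteq> bot" using \<open>F \<noteq> bot\<close> by (simp add: filtermap_bot_iff)
  ultimately obtain m where m: "inf (nhds m) (filtermap \<Phi> F) \<noteq> bot"
    using compact_functions_in_cballs[of B'] unfolding compact_filter by blast
  \<comment> \<open>Refining \<open>F\<close> by preimages of neighbourhoods of \<open>m\<close>
    forces \<open>\<Phi>\<close> to converge to \<open>m\<close>. That \<open>m\<close> is a cluster
    point is what keeps \<open>H\<close> proper.\<close>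
  define H where "H = inf F (filtercomap \<Phi> (nhds m))"
  have "H \<noteq> bot"
  proof
    assume "H = bot"
    then have "eventually (\<lambda>_. False) H" by simp
    then obtain P Q where P: "eventually P F" and Q: "eventually Q (nhds m)"
      and PQ: "\<And>i. P i \<Longrightarrow> Q (\<Phi> i) \<Longrightarrow> False"
      unfolding H_def eventually_inf eventually_filtercomap by metis
    have "eventually (\<lambda>g. \<not> Q g) (filtermap \<Phi> F)"
      unfolding eventually_filtermap using P by eventually_elim (use PQ in blast)
    with Q have "eventually (\<lambda>_. False) (inf (nhds m) (filtermap \<Phi> F))"
      unfolding eventually_inf by blast
    with m show False by (simp add: trivial_limit_def)
  qed
  have "H \<le> F" by (simp add: H_def)
  have \<Phi>_lim: "(\<Phi> \<longlongrightarrow> m) H"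
    by (rule filterlim_mono[OF filterlim_filtercomap order_refl]) (simp add: H_def)
  \<comment> \<open>Evaluation at \<open>f\<close> is continuous in the product topology.\<close>
  have coord: "((\<lambda>i. \<Phi> i f) \<longlongrightarrow> m f) H" for f
    using continuous_on_tendsto_compose[where s = UNIV and f = "\<lambda>g. g f", OF _ \<Phi>_lim] by simp
  have lim: "((\<lambda>i. f (e i)) \<longlongrightarrow> m f) H" if "f \<in> dual" for f
    using coord[of f] that by (simp add: \<Phi>_def)
  have "m \<in> bidual"
    unfolding bidual_def
  proof (intro CollectI conjI ballI allI exI[of _ C])
    fix f g :: "'a \<Rightarrow> complex" assume f: "f \<in> dual" and g: "g \<in> dual"
    show "m (\<lambda>x. f x + g x) = m f + m g"
      by (rule tendsto_unique[OF \<open>H \<noteq> bot\<close> lim[OF dual_add[OF f g]] tendsto_add[OF lim[OF f] lim[OF g]]])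
  next
    fix c and f :: "'a \<Rightarrow> complex" assume f: "f \<in> dual"
    show "m (\<lambda>x. c * f x) = c * m f"
      by (rule tendsto_unique[OF \<open>H \<noteq> bot\<close> lim[OF dual_mult[OF f]] tendsto_mult_left[OF lim[OF f]]])
  next
    fix f :: "'a \<Rightarrow> complex" assume f: "f \<in> dual"
    have "\<forall>\<^sub>F i in H. cmod (f (e i)) \<le> B f"
      using filter_leD[OF \<open>H \<le> F\<close> bound] by eventually_elim (use f in blast)
    then show "cmod (m f) \<le> C * onorm f"
      using tendsto_upperbound[OF tendsto_norm[OF lim[OF f]] _ \<open>H \<noteq> bot\<close>]
      by (simp add: B_def mult.commute)
  qed
  then show ?thesis using that \<open>H \<noteq> bot\<close> \<open>H \<le> F\<close> lim by blast
qed

section \<open>The two implications\<close>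

lemma net_filter_neq_bot:
  assumes "directed_set I le"
  shows "net_filter I le \<noteq> bot"
proof -
  have "le i i" if "i \<in> I" for i using assms that unfolding directed_set_def by blast
  then show ?thesis unfolding trivial_limit_def eventually_net_filter[OF assms] by blast
qed

lemma eventually_in_net:
  assumes "directed_set I le"
  shows "\<forall>\<^sub>F i in net_filter I le. i \<in> I"
proof -
  have "I \<noteq> {}" using assms unfolding directed_set_def by blast
  then show ?thesis unfolding eventually_net_filter[OF assms] by blast
qed

text \<open>Taking \<open>\<phi>\<close> from \<open>dual\<close> treats characters and the zero
  functional at once.\<close>

lemma Delta_weak_amenable_imp_approx_id:
  fixes \<phi> :: "'a::complex_banach_algebra \<Rightarrow> complex"
  assumes \<phi>: "\<phi> \<in> dual" and "Delta_weak_amenable \<phi>"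
  shows "has_bounded_Delta_weak_approx_id (ker \<phi>)"
proof -
  obtain m where m: "m \<in> bidual" "m \<phi> = 0"
    and act: "\<And>a \<psi>. a \<in> ker \<phi> \<Longrightarrow> \<psi> \<in> Delta \<Longrightarrow> m (dual_act \<psi> a) = \<psi> a"
    using assms(2) by (auto simp: Delta_weak_amenable_def)
  obtain I :: "(('a \<Rightarrow> complex) set \<times> nat) set" and le e K
    where dir: "directed_set I le" and K: "\<And>i. i \<in> I \<Longrightarrow> norm (e i) \<le> K"
      and lim: "\<And>f. f \<in> dual \<Longrightarrow> ((\<lambda>i. f (e i)) \<longlongrightarrow> m f) (net_filter I le)"
    using bidual_weak_star_limit[OF m(1)] by metis
  \<comment> \<open>This equation covers both cases: \<open>\<phi> u = 1\<close> if
    \<open>\<phi>\<close> is nonzero, and an arbitrary \<open>u\<close> otherwise.\<close>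
  obtain u where u: "\<phi> x * \<phi> u = \<phi> x" for x
  proof (cases "\<exists>v. \<phi> v \<noteq> 0")
    case True
    then obtain v where "\<phi> v \<noteq> 0" by blast
    then have "\<phi> (inverse (\<phi> v) *\<^sub>C v) = 1" by (simp add: dual_scaleC_arg[OF \<phi>])
    then show ?thesis by (intro that[of "inverse (\<phi> v) *\<^sub>C v"]) simp
  qed (use that in auto)
  define e' where "e' i = e i - \<phi> (e i) *\<^sub>C u" for i
  have "((\<lambda>i. cmod (\<psi> (a * e' i) - \<psi> a)) \<longlongrightarrow> 0) (net_filter I le)"
    if a: "a \<in> ker \<phi>" and \<psi>: "\<psi> \<in> Delta" for a \<psi>
  proof -
    have d: "dual_act \<psi> a \<in> dual" using \<psi> Delta_subset_dual by (blast intro: dual_act_in_dual)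
    have "((\<lambda>i. dual_act \<psi> a (e i) - \<phi> (e i) * dual_act \<psi> a u) \<longlongrightarrow> \<psi> a - 0 * dual_act \<psi> a u)
        (net_filter I le)"
      using lim[OF d] lim[OF \<phi>] by (intro tendsto_intros) (simp_all add: act[OF a \<psi>] m(2))
    moreover have "\<psi> (a * e' i) = dual_act \<psi> a (e i) - \<phi> (e i) * dual_act \<psi> a u" for i
      using dual_diff_arg[OF d, of "e i" "\<phi> (e i) *\<^sub>C u"] dual_scaleC_arg[OF d, of "\<phi> (e i)" u]
      by (simp add: e'_def dual_act_def)
    ultimately have "((\<lambda>i. \<psi> (a * e' i)) \<longlongrightarrow> \<psi> a) (net_filter I le)" by simp
    then show ?thesis by (simp add: Lim_null[of _ "\<psi> a"] tendsto_norm_zero_iff)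
  qed
  moreover have "e' ` I \<subseteq> ker \<phi>"
    by (auto simp: e'_def ker_def dual_diff_arg[OF \<phi>] dual_scaleC_arg[OF \<phi>] u)
  ultimately have net: "Delta_weak_approx_id (ker \<phi>) I le e'"
    using dir by (simp add: Delta_weak_approx_id_def)
  have "norm (e' i) \<le> K + onorm \<phi> * K * norm u" if "i \<in> I" for i
  proof -
    have "cmod (\<phi> (e i)) \<le> onorm \<phi> * norm (e i)" by (rule cmod_dual_le[OF \<phi>])
    also have "\<dots> \<le> onorm \<phi> * K"
      by (intro mult_left_mono K that onorm_pos_le dual_bounded_linear \<phi>)
    finally have "norm (\<phi> (e i) *\<^sub>C u) \<le> onorm \<phi> * K * norm u"
      by (simp add: norm_scaleC mult_right_mono)
    then show ?thesis
      using norm_triangle_ineq4[of "e i" "\<phi> (e i) *\<^sub>C u"] K[OF that] unfolding e'_def by linarith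
  qed
  then have "bounded (e' ` I)" unfolding bounded_iff by blast
  \<comment> \<open>The net is indexed by sets of functionals and numbers; this rule passes to the
    index type fixed in the definition.\<close>
  with net show ?thesis by (rule has_bounded_Delta_weak_approx_idI)
qed

lemma approx_id_imp_Delta_weak_amenable:
  fixes \<phi> :: "'a::complex_banach_algebra \<Rightarrow> complex"
  assumes \<phi>: "\<phi> \<in> dual" and "has_bounded_Delta_weak_approx_id (ker \<phi>)"
  shows "Delta_weak_amenable \<phi>"
proof -
  obtain I :: "('a \<times> 'a set) set" and le e
    where net: "Delta_weak_approx_id (ker \<phi>) I le e" and "bounded (e ` I)"
    using assms(2) unfolding has_bounded_Delta_weak_approx_id_def by blast
  then obtain C where C: "\<And>i. i \<in> I \<Longrightarrow> norm (e i) \<le> C" by (auto simp: bounded_iff)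
  have dir: "directed_set I le" using net by (simp add: Delta_weak_approx_id_def)
  have inI: "\<forall>\<^sub>F i in net_filter I le. i \<in> I" by (rule eventually_in_net[OF dir])
  then have "\<forall>\<^sub>F i in net_filter I le. norm (e i) \<le> C" by eventually_elim (rule C)
  then obtain m H where m: "m \<in> bidual" and H: "H \<noteq> bot" "H \<le> net_filter I le"
    and lim: "\<And>f. f \<in> dual \<Longrightarrow> ((\<lambda>i. f (e i)) \<longlongrightarrow> m f) H"
    using weak_star_cluster_point[OF net_filter_neq_bot[OF dir]] by metis
  \<comment> \<open>The net lies in \<open>ker \<phi>\<close>, so the limit \<open>m \<phi>\<close>
    is a limit of zeros.\<close>
  have "\<forall>\<^sub>F i in H. 0 = \<phi> (e i)"
    using filter_leD[OF H(2) inI]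
    by eventually_elim (use net in \<open>auto simp: Delta_weak_approx_id_def ker_def\<close>)
  then have "((\<lambda>i. \<phi> (e i)) \<longlongrightarrow> 0) H"
    by (rule Lim_transform_eventually[OF tendsto_const])
  then have "m \<phi> = 0" using tendsto_unique[OF H(1) lim[OF \<phi>]] by blast
  moreover have "m (dual_act \<psi> a) = \<psi> a" if "a \<in> ker \<phi>" "\<psi> \<in> Delta" for a \<psi>
  proof -
    have "((\<lambda>i. cmod (\<psi> (a * e i) - \<psi> a)) \<longlongrightarrow> 0) (net_filter I le)"
      using net that by (simp add: Delta_weak_approx_id_def)
    then have "((\<lambda>i. dual_act \<psi> a (e i)) \<longlongrightarrow> \<psi> a) (net_filter I le)"
      by (simp add: dual_act_def Lim_null[of _ "\<psi> a"] tendsto_norm_zero_iff)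
    moreover have "dual_act \<psi> a \<in> dual"
      using that Delta_subset_dual by (blast intro: dual_act_in_dual)
    \<comment> \<open>Along the finer filter \<open>H\<close> the same values tend to
      \<open>m (dual_act \<psi> a)\<close> and to \<open>\<psi> a\<close>; limits along a proper
      filter are unique.\<close>
    ultimately show ?thesis
      using tendsto_unique[OF H(1) lim] tendsto_mono[OF H(2)] by blast
  qed
  ultimately show ?thesis using m by (auto simp: Delta_weak_amenable_def)
qed

theorem theorem2p2:
  fixes \<phi> :: "'a::complex_banach_algebra \<Rightarrow> complex"
  assumes "(Delta :: ('a \<Rightarrow> complex) set) \<noteq> {}"
    and "\<phi> \<in> Delta \<union> {\<lambda>_. 0}"
  shows "Delta_weak_amenable \<phi> \<longleftrightarrow> has_bounded_Delta_weak_approx_id (ker \<phi>)"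
proof -
  have "\<phi> \<in> dual" using assms(2) Delta_subset_dual zero_in_dual by blast
  then show ?thesis
    using Delta_weak_amenable_imp_approx_id approx_id_imp_Delta_weak_amenable by blast
qed

end
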